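(* Let $R$ be a commutative semiring, let $S\subseteq\operatorname{Reg}(R)$ be a multiplicatively closed subset of $R$, and let $I$ be an ideal of $R$. Then $I$ is a quasi $S$-$n$-ideal of $R$ if and only if $(I:s)$ is a quasi $n$-ideal of $R$ for some $s\in S$.
   Context: All semirings are commutative with identity $1\neq 0$. A subset $S$ of $R$ is multiplicatively closed if $0\notin S$, $1\in S$, and $st\in S$ for all $s,t\in S$. $\operatorname{Reg}(R)$ is the set of regular elements of $R$, i.e. elements that are not zero-divisors. $N(R)$ denotes the nilradical (set of nilpotent elements) of $R$. For an ideal $I$ and $r\in R$, $(I:r)=\{x\in R: rx\in I\}$. A proper ideal $I$ of $R$ with $I\cap S=\emptyset$ is a quasi $S$-$n$-ideal of $R$ if there exists a fixed element $s\in S$ such that, for all $a,b\in R$, $ab\in I$ implies $sa^2\in I$ or $sb\in N(R)$. A proper ideal $I$ of $R$ is a quasi $n$-ideal if for all $a,b\in R$, $ab\in I$ implies $a^2\in I$ or $b\in N(R)$. *)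

theory Defs
  imports Main
begin

text \<open>
  The type class \<open>comm_semiring_1\<close> is the class of commutative semirings with \<open>0\<close> absorbing
  and \<open>1 \<noteq> 0\<close>; additive cancellation is not assumed.
\<close>

definition is_ideal :: "'a::comm_semiring_1 set \<Rightarrow> bool" where
  "is_ideal I \<longleftrightarrow>
     I \<noteq> {} \<and> (\<forall>a\<in>I. \<forall>b\<in>I. a + b \<in> I) \<and> (\<forall>r. \<forall>a\<in>I. r * a \<in> I)"

definition proper_ideal :: "'a::comm_semiring_1 set \<Rightarrow> bool" where
  "proper_ideal I \<longleftrightarrow> is_ideal I \<and> I \<noteq> UNIV"

definition multiplicatively_closed :: "'a::comm_semiring_1 set \<Rightarrow> bool" where
  "multiplicatively_closed S \<longleftrightarrow> 0 \<notin> S \<and> 1 \<in> S \<and> (\<forall>s\<in>S. \<forall>t\<in>S. s * t \<in> S)"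

definition zero_divisor :: "'a::comm_semiring_1 \<Rightarrow> bool" where
  "zero_divisor r \<longleftrightarrow> (\<exists>x. x \<noteq> 0 \<and> r * x = 0)"

text \<open>
  Regular means \<^emph>\<open>not a zero-divisor\<close>, which for a semiring is weaker than being
  multiplicatively cancellable.
\<close>

definition Reg :: "'a::comm_semiring_1 set" where
  "Reg = {r. \<not> zero_divisor r}"

definition nilradical :: "'a::comm_semiring_1 set" where
  "nilradical = {a. \<exists>n. a ^ n = 0}"

definition colon :: "'a::comm_semiring_1 set \<Rightarrow> 'a \<Rightarrow> 'a set" where
  "colon I r = {x. r * x \<in> I}"

definition quasi_n_ideal :: "'a::comm_semiring_1 set \<Rightarrow> bool" where
  "quasi_n_ideal I \<longleftrightarrow>
     proper_ideal I \<and> (\<forall>a b. a * b \<in> I \<longrightarrow> a\<^sup>2 \<in> I \<or> b \<in> nilradical)"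

definition quasi_S_n_ideal :: "'a::comm_semiring_1 set \<Rightarrow> 'a set \<Rightarrow> bool" where
  "quasi_S_n_ideal S I \<longleftrightarrow>
     proper_ideal I \<and> I \<inter> S = {} \<and>
     (\<exists>s\<in>S. \<forall>a b. a * b \<in> I \<longrightarrow> s * a\<^sup>2 \<in> I \<or> s * b \<in> nilradical)"

end

theory Submission
  imports Defs
begin

text \<open>
  The same \<open>s\<close> works in both directions. Since \<open>(I : s)\<close> contains \<open>I\<close>, and since
  \<open>s * a\<^sup>2 \<in> I\<close> says that \<open>a\<^sup>2 \<in> (I : s)\<close>, the two absorption conditions differ only by powers of
  \<open>s\<close> in front of \<open>b\<close>. Regularity cancels these: if \<open>s * b\<close> is nilpotent, so is \<open>b\<close>
  (\<open>mult_regular_in_nilradicalD\<close>). The remaining point is that \<open>I\<close> misses \<open>S\<close>. A quasi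
  \<open>n\<close>-ideal consists of nilpotent elements (\<open>quasi_n_ideal_subset_nilradical\<close>), whereas a
  multiplicatively closed set contains none, because it contains the powers of its elements
  but not \<open>0\<close>.
\<close>

lemma multiplicatively_closed_power:
  assumes "multiplicatively_closed S" and "s \<in> S"
  shows "s ^ n \<in> S"
  using assms by (induction n) (auto simp: multiplicatively_closed_def)

lemma multiplicatively_closed_disjoint_nilradical:
  assumes "multiplicatively_closed S"
  shows "S \<inter> nilradical = {}"
proof -
  have "s ^ n \<noteq> 0" if "s \<in> S" for s n
    using multiplicatively_closed_power[OF assms that, of n] assms
    by (auto simp: multiplicatively_closed_def)
  then show ?thesis
    by (auto simp: nilradical_def)
qed

lemma Reg_mult_eq_0D:
  assumes "s \<in> Reg" and "s * x = 0"
  shows "x = 0"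
  using assms by (auto simp: Reg_def zero_divisor_def)

lemma Reg_power_mult_eq_0D:
  assumes "s \<in> Reg" and "s ^ n * x = 0"
  shows "x = 0"
  using assms(2)
  by (induction n) (auto simp: mult.assoc dest: Reg_mult_eq_0D[OF assms(1)])

lemma mult_in_nilradical:
  assumes "x \<in> nilradical"
  shows "r * x \<in> nilradical"
proof -
  from assms obtain n where "x ^ n = 0"
    by (auto simp: nilradical_def)
  then have "(r * x) ^ n = 0"
    by (simp add: power_mult_distrib)
  then show ?thesis
    by (auto simp: nilradical_def)
qed

text \<open>
  Without subtraction, a regular \<open>s\<close> need not be cancellable in \<open>s * x = s * y\<close>. Nilpotency only
  asks for \<open>s ^ n * x ^ n = 0\<close>, where the factors \<open>s\<close> can be removed one at a time.
\<close>
lemma mult_regular_in_nilradicalD: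
  assumes "s \<in> Reg" and "s * x \<in> nilradical"
  shows "x \<in> nilradical"
  using assms by (auto simp: nilradical_def power_mult_distrib dest: Reg_power_mult_eq_0D)

lemma is_ideal_colon:
  assumes "is_ideal I"
  shows "is_ideal (colon I r)"
proof -
  have "colon I r \<noteq> {}"
    using assms by (fastforce simp: is_ideal_def colon_def)
  then show ?thesis
    using assms by (auto simp: is_ideal_def colon_def distrib_left mult.left_commute)
qed

lemma subset_colon:
  assumes "is_ideal I"
  shows "I \<subseteq> colon I r"
  using assms by (auto simp: is_ideal_def colon_def)

lemma ideal_with_one_eq_UNIV:
  assumes "is_ideal I" and "1 \<in> I"
  shows "I = UNIV"
proof -
  have "r \<in> I" for r
    using assms unfolding is_ideal_def by (metis mult.right_neutral)
  then show ?thesis by blast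
qed

text \<open>
  Apply the defining condition to \<open>1 * b \<in> J\<close>: the alternative \<open>1\<^sup>2 \<in> J\<close> contradicts properness.
\<close>
lemma quasi_n_ideal_subset_nilradical:
  assumes "quasi_n_ideal J"
  shows "J \<subseteq> nilradical"
proof
  fix b assume "b \<in> J"
  then have "1\<^sup>2 \<in> J \<or> b \<in> nilradical"
    using assms unfolding quasi_n_ideal_def by (metis mult_1)
  moreover have "1 \<notin> J"
    using assms ideal_with_one_eq_UNIV by (auto simp: quasi_n_ideal_def proper_ideal_def)
  ultimately show "b \<in> nilradical" by simp
qed

theorem proposition2p17:
  fixes S I :: "'a::comm_semiring_1 set"
  assumes "multiplicatively_closed S"
    and "S \<subseteq> Reg"
    and "is_ideal I"
  shows "quasi_S_n_ideal S I \<longleftrightarrow> (\<exists>s\<in>S. quasi_n_ideal (colon I s))"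
proof
  assume "quasi_S_n_ideal S I"
  then obtain s where s: "s \<in> S" and disj: "I \<inter> S = {}"
    and absorb: "\<And>a b. a * b \<in> I \<Longrightarrow> s * a\<^sup>2 \<in> I \<or> s * b \<in> nilradical"
    unfolding quasi_S_n_ideal_def by blast
  from s assms(2) have reg: "s \<in> Reg" by blast
  have "1 \<notin> colon I s"
    using s disj by (auto simp: colon_def)
  then have "proper_ideal (colon I s)"
    using is_ideal_colon[OF assms(3)] by (auto simp: proper_ideal_def)
  moreover have "a\<^sup>2 \<in> colon I s \<or> b \<in> nilradical" if "a * b \<in> colon I s" for a b
  proof -
    \<comment> \<open>Attaching the factor \<open>s\<close> to \<open>b\<close> rather than to \<open>a\<close> leaves it where regularity can cancel it.\<close>
    have "a * (s * b) \<in> I"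
      using that by (simp add: colon_def mult.left_commute)
    then have "s * a\<^sup>2 \<in> I \<or> s * (s * b) \<in> nilradical"
      by (rule absorb)
    then show ?thesis
      using mult_regular_in_nilradicalD[OF reg] by (auto simp: colon_def)
  qed
  ultimately show "\<exists>s\<in>S. quasi_n_ideal (colon I s)"
    using s unfolding quasi_n_ideal_def by blast
next
  assume "\<exists>s\<in>S. quasi_n_ideal (colon I s)"
  then obtain s where s: "s \<in> S" and quasi: "quasi_n_ideal (colon I s)" by blast
  note sub = subset_colon[OF assms(3), of s]
  have "I \<noteq> UNIV"
    using quasi sub by (auto simp: quasi_n_ideal_def proper_ideal_def)
  then have "proper_ideal I"
    using assms(3) by (simp add: proper_ideal_def)
  moreover have "I \<inter> S = {}"
    using sub quasi_n_ideal_subset_nilradical[OF quasi]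
      multiplicatively_closed_disjoint_nilradical[OF assms(1)] by blast
  moreover have "s * a\<^sup>2 \<in> I \<or> s * b \<in> nilradical" if "a * b \<in> I" for a b
  proof -
    have "a\<^sup>2 \<in> colon I s \<or> b \<in> nilradical"
      using that sub quasi unfolding quasi_n_ideal_def by blast
    then show ?thesis
      using mult_in_nilradical by (auto simp: colon_def)
  qed
  ultimately show "quasi_S_n_ideal S I"
    using s unfolding quasi_S_n_ideal_def by blast
qed

end
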